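(* Let $v>k>i\ge 0$ be integers with $v\ge 2k$ and $(v,k,i)\neq(2k,k,0)$, let $X=J(v,k,i)$ and $\Delta=v-2k+2i$. Then $$\mathrm{diam}(X)= \begin{cases} \lceil \frac{k-i-1}{\Delta} \rceil+1 & \text{if } v<3(k-i)-1 \text{ or } i=0; \\ 3 & \text{if } 3(k-i)-1\leq v <3k-2i \text{ and } i\neq 0;\\ \lceil\frac{k}{k-i}\rceil & \text{if } v \geq 3k-2i \text{ and } i\neq 0. \end{cases}$$
   Context: For integers $v>k>i\ge 0$, the generalized Johnson graph $J(v,k,i)$ is the simple undirected graph whose vertices are the $k$-element subsets of a fixed $v$-element set, two vertices $A,B$ being adjacent iff $|A\cap B|=i$. $\mathrm{diam}$ denotes the diameter (maximum graph distance). *)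

theory Defs
  imports "Graph_Theory.Pair_Digraph" "Graph_Theory.Shortest_Path"
begin

text \<open>
  Following \<^theory>\<open>Graph_Theory.Digraph\<close>, an undirected graph is a symmetric digraph:
  every edge is represented by its two orientations. The ground set \<open>S\<close> is the fixed
  \<open>v\<close>-element set, so that \<open>J(v,k,i)\<close> is \<open>gen_johnson S k i\<close> with \<open>card S = v\<close>.
\<close>

definition gen_johnson :: "'a set \<Rightarrow> nat \<Rightarrow> nat \<Rightarrow> 'a set pair_pre_digraph" where
  "gen_johnson S k i =
     \<lparr> pverts = {A. A \<subseteq> S \<and> card A = k},
       parcs = {(A, B). A \<subseteq> S \<and> card A = k \<and> B \<subseteq> S \<and> card B = k \<and> card (A \<inter> B) = i} \<rparr>"

lemma pair_graph_gen_johnson: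
  assumes "finite S" and "i < k"
  shows "pair_graph (gen_johnson S k i)"
proof
  show "finite (pverts (gen_johnson S k i))"
    using assms by (simp add: gen_johnson_def)
  have "parcs (gen_johnson S k i) \<subseteq> Pow S \<times> Pow S"
    by (auto simp: gen_johnson_def)
  then show "finite (parcs (gen_johnson S k i))"
    using assms by (meson finite_Pow_iff finite_SigmaI finite_subset)
  have "sym (parcs (gen_johnson S k i))"
    by (rule symI) (simp add: gen_johnson_def Int_commute)
  then show "symmetric (with_proj (gen_johnson S k i))"
    by (simp add: symmetric_def)
next
  fix e assume e: "e \<in> parcs (gen_johnson S k i)"
  show "fst e \<in> pverts (gen_johnson S k i)" "snd e \<in> pverts (gen_johnson S k i)"
    using e by (simp_all add: gen_johnson_def case_prod_unfold)
  show "fst e \<noteq> snd e"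
  proof
    assume "fst e = snd e"
    with e have "card (fst e) = k" "card (fst e) = i"
      by (simp_all add: gen_johnson_def case_prod_unfold)
    with assms show False by simp
  qed
qed

text \<open>
  The distance of two vertices is the least cost of a walk between them when every arc
  has cost 1; it is \<open>\<infinity>\<close> if there is no such walk, and so is then the diameter.
\<close>

definition graph_dist :: "('a, 'b) pre_digraph \<Rightarrow> 'a \<Rightarrow> 'a \<Rightarrow> ereal" where
  "graph_dist G u w = wf_digraph.\<mu> G (\<lambda>_. 1) u w"

definition diameter :: "('a, 'b) pre_digraph \<Rightarrow> ereal" where
  "diameter G = (SUP u\<in>verts G. SUP w\<in>verts G. graph_dist G u w)"

end

theory Submission
  imports Defs
begin

text \<open>
  In \<open>J(v,k,i)\<close> the distance of \<open>A\<close> and \<open>B\<close> depends only on \<open>s = |A - B|\<close>, and \<open>A\<close>, \<open>B\<close> are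
  adjacent iff \<open>s = r\<close> where \<open>r = k - i\<close>. Two vertices have a common neighbour (or are equal)
  iff \<open>s \<le> m\<close> where \<open>m = min \<Delta> (2 r)\<close>. As \<open>|A - B|\<close> is a metric with plenty of intermediate points,
  a walk of length \<open>2 t\<close> joins \<open>A\<close> to \<open>B\<close> iff \<open>s \<le> t m\<close>, and one of length \<open>2 t + 1\<close> iff
  \<open>|s - r| \<le> t m\<close>. Asking that all \<open>s \<le> k\<close> be reached in at most \<open>N \<ge> 1\<close> steps amounts to
  \<open>(N - 1) m \<ge> r - 1\<close> together with \<open>\<lfloor>(N - 1) / 2\<rfloor> m \<ge> i\<close> or \<open>\<lfloor>N / 2\<rfloor> m \<ge> k\<close>; the three cases
  of the formula give the least such \<open>N\<close>.
\<close>

section \<open>Distance and diameter through powers of the adjacency relation\<close>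

text \<open>Passing to relation powers lets walks be split and joined by \<open>relpow_add\<close>.
  Vertexhood of \<open>u\<close> is stated separately because the zeroth power relates every point
  to itself.\<close>

lemma (in wf_digraph) awalk_length_iff_relpow:
  "(\<exists>p. awalk u p w \<and> length p = n) \<longleftrightarrow> u \<in> verts G \<and> (u, w) \<in> arcs_ends G ^^ n"
proof (induction n arbitrary: u)
  case 0
  then show ?case by (auto simp: awalk_Nil_iff)
next
  case (Suc n)
  have "(\<exists>p. awalk u p w \<and> length p = Suc n) \<longleftrightarrow>
      (\<exists>e\<in>arcs G. u = tail G e \<and> (\<exists>p. awalk (head G e) p w \<and> length p = n))"
    by (simp add: length_Suc_conv) (metis awalk_Cons_iff)
  also have "\<dots> \<longleftrightarrow> (\<exists>e\<in>arcs G. u = tail G e \<and> (head G e, w) \<in> arcs_ends G ^^ n)"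
    by (auto simp: Suc.IH)
  also have "\<dots> \<longleftrightarrow> u \<in> verts G \<and> (u, w) \<in> arcs_ends G O arcs_ends G ^^ n"
    by (auto simp: arcs_ends_def arc_to_ends_def)
  also have "arcs_ends G O arcs_ends G ^^ n = arcs_ends G ^^ Suc n"
    by (simp add: relpow_commute)
  finally show ?case .
qed

lemma (in wf_digraph) awalk_cost_one: "awalk_cost (\<lambda>_. 1) p = real (length p)"
  by (induction p) auto

lemma (in wf_digraph) graph_dist_le:
  assumes "u \<in> verts G" "(u, w) \<in> arcs_ends G ^^ n"
  shows "graph_dist G u w \<le> ereal (real n)"
proof -
  obtain p where "awalk u p w" "length p = n"
    using assms awalk_length_iff_relpow by blast
  then show ?thesis
    unfolding graph_dist_def by (metis awalk_cost_one min_cost_le_walk_cost)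
qed

lemma (in wf_digraph) le_graph_dist:
  assumes "\<And>n. n < N \<Longrightarrow> (u, w) \<notin> arcs_ends G ^^ n"
  shows "ereal (real N) \<le> graph_dist G u w"
  unfolding graph_dist_def \<mu>_def
proof (rule INF_greatest)
  fix p assume "p \<in> {p. awalk u p w}"
  then have "(u, w) \<in> arcs_ends G ^^ length p"
    using awalk_length_iff_relpow by blast
  then show "ereal (real N) \<le> ereal (awalk_cost (\<lambda>_. 1) p)"
    using assms by (auto simp: awalk_cost_one not_less[symmetric])
qed

lemma (in wf_digraph) diameter_eqI:
  assumes le: "\<And>u w. u \<in> verts G \<Longrightarrow> w \<in> verts G \<Longrightarrow> \<exists>n\<le>N. (u, w) \<in> arcs_ends G ^^ n"
    and "u \<in> verts G" "w \<in> verts G" "\<And>n. n < N \<Longrightarrow> (u, w) \<notin> arcs_ends G ^^ n"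
  shows "diameter G = ereal (real N)"
proof (rule antisym)
  show "diameter G \<le> ereal (real N)"
    unfolding diameter_def
  proof (intro SUP_least)
    fix u w assume uw: "u \<in> verts G" "w \<in> verts G"
    then obtain n where "n \<le> N" "(u, w) \<in> arcs_ends G ^^ n"
      using le by blast
    then show "graph_dist G u w \<le> ereal (real N)"
      using graph_dist_le[OF uw(1)] by (meson ereal_less_eq(3) of_nat_mono order_trans)
  qed
  show "ereal (real N) \<le> diameter G"
    unfolding diameter_def using assms le_graph_dist by (meson SUP_upper2)
qed

section \<open>The metric \<open>|A - B|\<close> on sets of equal size\<close>

lemma card_Diff_commute:
  assumes "finite A" "finite B" "card A = card B"
  shows "card (A - B) = card (B - A)"
  using assms card_Diff_subset_Int[of A B] card_Diff_subset_Int[of B A]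
  by (simp add: Int_commute)

lemma card_Diff_triangle:
  assumes "finite A" "finite B"
  shows "card (A - C) \<le> card (A - B) + card (B - C)"
proof -
  have "card (A - C) \<le> card ((A - B) \<union> (B - C))"
    using assms by (intro card_mono) auto
  also have "\<dots> \<le> card (A - B) + card (B - C)"
    by (rule card_Un_le)
  finally show ?thesis .
qed

lemma card_exchange:
  assumes "finite A" "X \<subseteq> A" "Y \<inter> A = {}" "finite Y" "card X = card Y"
  shows "card (A - X \<union> Y) = card A"
proof -
  have "card (A - X \<union> Y) = card (A - X) + card Y"
    using assms by (intro card_Un_disjoint) auto
  moreover have "card (A - X) = card A - card X"
    using assms by (auto simp: card_Diff_subset finite_subset)
  moreover have "card X \<le> card A"
    using assms by (intro card_mono)
  ultimately show ?thesis using assms by simp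
qed

text \<open>Exchanging \<open>j\<close> elements of \<open>A - B\<close> for \<open>j\<close>
  elements of \<open>B - A\<close> moves \<open>A\<close> straight towards \<open>B\<close>.\<close>

lemma intermediate_set:
  assumes "finite A" "finite B" "card A = card B" "j \<le> card (A - B)"
  obtains M where "M \<subseteq> A \<union> B" "card M = card A" "card (A - M) = j" "card (M - B) = card (A - B) - j"
proof -
  obtain X where X: "X \<subseteq> A - B" "card X = j" "finite X"
    using obtain_subset_with_card_n[OF assms(4)] by blast
  obtain Y where Y: "Y \<subseteq> B - A" "card Y = j" "finite Y"
    using assms card_Diff_commute[of A B] obtain_subset_with_card_n[of j "B - A"] by auto
  let ?M = "A - X \<union> Y"
  have "A - ?M = X" "?M - B = (A - B) - X"
    using X Y by auto
  moreover have "card ?M = card A"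
    using X Y assms by (intro card_exchange) auto
  ultimately show thesis
    using X Y by (intro that[of ?M]) (auto simp: card_Diff_subset)
qed

text \<open>Exchanging \<open>j\<close> common elements for \<open>j\<close> elements outside both
  sets moves away from \<open>A\<close> and from \<open>B\<close> at once.\<close>

lemma extension_set:
  assumes "finite S" "A \<subseteq> S" "B \<subseteq> S" "j \<le> card (A \<inter> B)" "j \<le> card (S - (A \<union> B))"
  obtains M where "M \<subseteq> S" "card M = card A" "card (A - M) = j" "card (M - B) = card (A - B) + j"
proof -
  have fin: "finite A" "finite B" using assms finite_subset by blast+
  obtain X where X: "X \<subseteq> A \<inter> B" "card X = j" "finite X"
    using obtain_subset_with_card_n[OF assms(4)] by blast
  obtain Y where Y: "Y \<subseteq> S - (A \<union> B)" "card Y = j" "finite Y"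
    using obtain_subset_with_card_n[OF assms(5)] by blast
  let ?M = "A - X \<union> Y"
  have "A - ?M = X" "?M - B = (A - B) \<union> Y"
    using X Y by auto
  moreover have "card ((A - B) \<union> Y) = card (A - B) + card Y"
    using Y fin by (intro card_Un_disjoint) auto
  moreover have "card ?M = card A"
    using X Y fin by (intro card_exchange) auto
  ultimately show thesis
    using X Y assms(2) by (intro that[of ?M]) auto
qed

section \<open>Walks in generalized Johnson graphs\<close>

locale johnson =
  fixes S :: "'a set" and k i :: nat
  assumes finite_S: "finite S" and i_less: "i < k" and card_ge: "2 * k \<le> card S"
begin

text \<open>The first argument of \<open>min\<close> is \<Delta>; subtracting last keeps it exact,
  since \<open>2 * k \<le> card S\<close>.\<close>

definition m :: nat where "m = min (card S + 2 * i - 2 * k) (2 * (k - i))"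

abbreviation V :: "'a set set" where "V \<equiv> {A. A \<subseteq> S \<and> card A = k}"

abbreviation E :: "('a set \<times> 'a set) set" where "E \<equiv> parcs (gen_johnson S k i)"

lemma finite_vertex: "A \<in> V \<Longrightarrow> finite A"
  using finite_S finite_subset by blast

lemma card_Int_vertex: "A \<in> V \<Longrightarrow> card (A \<inter> B) = k - card (A - B)"
  using card_Int_Diff[OF finite_vertex[of A], of B] by simp

lemma card_Diff_vertex_le: "A \<in> V \<Longrightarrow> card (A - B) \<le> k"
  using card_mono[OF finite_vertex[of A] Diff_subset[of A B]] by simp

lemma card_outside:
  assumes "A \<in> V" "B \<in> V"
  shows "card (S - (A \<union> B)) = card S - k - card (A - B)"
proof -
  have "card (A \<union> B) = k + card (A - B)"
    using assms card_Un_disjoint[of B "A - B"] finite_vertex[OF assms(1)] finite_vertex[OF assms(2)]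
    by (simp add: Un_commute)
  then show ?thesis
    using assms card_Diff_subset[of "A \<union> B" S] finite_vertex[OF assms(1)] finite_vertex[OF assms(2)]
    by simp
qed

lemma E_iff: "(A, B) \<in> E \<longleftrightarrow> A \<in> V \<and> B \<in> V \<and> card (A - B) = k - i"
  using i_less card_Int_vertex[of A B] card_Diff_vertex_le[of A B]
  by (auto simp: gen_johnson_def)

lemma card_Diff_sym: "A \<in> V \<Longrightarrow> B \<in> V \<Longrightarrow> card (A - B) = card (B - A)"
  by (intro card_Diff_commute finite_vertex) simp_all

lemma card_Diff_vertex_triangle:
  "A \<in> V \<Longrightarrow> B \<in> V \<Longrightarrow> card (A - C) \<le> card (A - B) + card (B - C)"
  by (rule card_Diff_triangle) (rule finite_vertex, assumption)+

text \<open>The bound \<open>2 * (k - i)\<close> is the triangle inequality. For \<Delta>, a common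
  neighbour has at most \<open>2 * i\<close> elements in \<open>A \<union> B\<close>, so at least
  \<open>k - 2 * i\<close> must fit outside, where only \<open>card S - k - card (A - B)\<close> are
  available.\<close>

lemma two_steps_necessary:
  assumes "(A, C) \<in> E" "(C, B) \<in> E"
  shows "card (A - B) \<le> m"
proof -
  have V: "A \<in> V" "B \<in> V" "C \<in> V" using assms by (auto simp: E_iff)
  note fin = V[THEN finite_vertex]
  have "card (C \<inter> A) = i" "card (C \<inter> B) = i"
    using assms by (auto simp: gen_johnson_def Int_commute)
  then have "card (C \<inter> (A \<union> B)) \<le> 2 * i"
    using card_Un_le[of "C \<inter> A" "C \<inter> B"] by (simp add: Int_Un_distrib)
  moreover have "card (C - (A \<union> B)) + card (C \<inter> (A \<union> B)) = k"
    using V fin card_Int_Diff[of C "A \<union> B"] by simp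
  moreover have "card (C - (A \<union> B)) \<le> card (S - (A \<union> B))"
    using V finite_S by (intro card_mono) auto
  moreover note card_outside[OF V(1,2)]
  moreover have "card (A - B) \<le> card (A - C) + card (C - B)"
    by (rule card_Diff_vertex_triangle[OF V(1,3)])
  moreover have "card (A - C) = k - i" "card (C - B) = k - i"
    using assms by (auto simp: E_iff)
  ultimately show ?thesis
    using card_ge i_less card_Diff_vertex_le[OF V(1), of B] by (auto simp: m_def)
qed

text \<open>A common neighbour is assembled from \<open>a\<close> elements of
  \<open>A \<inter> B\<close>, \<open>i - a\<close> of each difference, and the rest from outside
  \<open>A \<union> B\<close>.\<close>

lemma two_steps_sufficient:
  assumes V: "A \<in> V" "B \<in> V" and le: "card (A - B) \<le> m"
  shows "(A, B) \<in> E ^^ 2"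
proof -
  note fin = V[THEN finite_vertex]
  let ?s = "card (A - B)"
  \<comment> \<open>The least admissible value: \<open>i - a\<close> must fit into
    \<open>A - B\<close>, and the two intersections together may not exceed \<open>k\<close>
    elements. Truncated subtraction supplies \<open>0 \<le> a\<close>. That \<open>X\<close> fits
    uses \<open>?s \<le> 2 * (k - i)\<close>; that \<open>W\<close> fits uses
    \<open>?s \<le> \<Delta>\<close> when \<open>a = 0\<close>.\<close>
  define a where "a = max (i - ?s) (2 * i - k)"
  have s: "?s \<le> k" using V card_Diff_vertex_le by blast
  have "a \<le> card (A \<inter> B)"
    using s le i_less card_Int_vertex[OF V(1), of B] by (auto simp: a_def m_def)
  then obtain X where X: "X \<subseteq> A \<inter> B" "card X = a" "finite X"
    using obtain_subset_with_card_n by blast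
  have "i - a \<le> card (A - B)" by (auto simp: a_def)
  then obtain Y where Y: "Y \<subseteq> A - B" "card Y = i - a" "finite Y"
    using obtain_subset_with_card_n by blast
  have "i - a \<le> card (B - A)"
    using card_Diff_sym[OF V] by (auto simp: a_def)
  then obtain Z where Z: "Z \<subseteq> B - A" "card Z = i - a" "finite Z"
    using obtain_subset_with_card_n by blast
  have "k + a - 2 * i \<le> card (S - (A \<union> B))"
    using s le i_less card_ge by (auto simp: card_outside[OF V] a_def m_def)
  then obtain W where W: "W \<subseteq> S - (A \<union> B)" "card W = k + a - 2 * i" "finite W"
    using obtain_subset_with_card_n by blast
  let ?C = "X \<union> Y \<union> Z \<union> W"
  have a: "a \<le> i" "2 * i \<le> k + a" using i_less by (auto simp: a_def)
  have "card ?C = card X + card Y + card Z + card W"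
  proof -
    have "card ?C = card (X \<union> Y \<union> Z) + card W"
      using X Y Z W by (intro card_Un_disjoint) auto
    also have "card (X \<union> Y \<union> Z) = card (X \<union> Y) + card Z"
      using X Y Z by (intro card_Un_disjoint) auto
    also have "card (X \<union> Y) = card X + card Y"
      using X Y by (intro card_Un_disjoint) auto
    finally show ?thesis .
  qed
  then have "card ?C = k" using X Y Z W a by simp
  moreover have "?C \<subseteq> S" using X Y Z W V by auto
  moreover have "card (A \<inter> ?C) = i"
  proof -
    have "A \<inter> ?C = X \<union> Y" using X Y Z W by auto
    moreover have "card (X \<union> Y) = card X + card Y"
      using X Y by (intro card_Un_disjoint) auto
    ultimately show ?thesis using X Y a by simp
  qed
  moreover have "card (?C \<inter> B) = i"
  proof -
    have "?C \<inter> B = X \<union> Z" using X Y Z W by auto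
    moreover have "card (X \<union> Z) = card X + card Z"
      using X Z by (intro card_Un_disjoint) auto
    ultimately show ?thesis using X Z a by simp
  qed
  ultimately have "(A, ?C) \<in> E" "(?C, B) \<in> E"
    using V by (auto simp: gen_johnson_def)
  then show ?thesis by (auto simp: numeral_2_eq_2)
qed

lemma even_walk_necessary:
  assumes "A \<in> V" "(A, B) \<in> E ^^ (2 * t)"
  shows "B \<in> V \<and> card (A - B) \<le> t * m"
  using assms(2)
proof (induction t arbitrary: B)
  case 0
  then show ?case using assms(1) by simp
next
  case (Suc t)
  then obtain M C where M: "(A, M) \<in> E ^^ (2 * t)" and C: "(M, C) \<in> E" "(C, B) \<in> E"
    by auto
  have "card (A - M) \<le> t * m" by (rule conjunct2[OF Suc.IH[OF M]])
  moreover have "card (M - B) \<le> m" by (rule two_steps_necessary[OF C])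
  moreover have "B \<in> V" "M \<in> V" using C by (auto simp: E_iff)
  moreover have "card (A - B) \<le> card (A - M) + card (M - B)"
    by (rule card_Diff_vertex_triangle[OF assms(1) \<open>M \<in> V\<close>])
  ultimately show ?case by simp
qed

lemma even_walk_sufficient:
  assumes "A \<in> V" "B \<in> V" "card (A - B) \<le> t * m"
  shows "(A, B) \<in> E ^^ (2 * t)"
  using assms(2,3)
proof (induction t arbitrary: B)
  case 0
  then have "A \<subseteq> B" using finite_vertex[OF assms(1)] by simp
  then have "A = B"
    using 0 assms(1) card_subset_eq[OF finite_vertex[OF 0(1)]] by simp
  then show ?case by simp
next
  case (Suc t)
  \<comment> \<open>If \<open>t * m\<close> already exceeds the distance, then \<open>M\<close> is
    at distance 0 from \<open>B\<close>, and the last two steps go from \<open>B\<close> to a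
    neighbour and back.\<close>
  let ?j = "min (t * m) (card (A - B))"
  obtain M where M: "M \<subseteq> A \<union> B" "card M = card A" "card (A - M) = ?j"
    "card (M - B) = card (A - B) - ?j"
  proof (rule intermediate_set[of A B ?j])
    show "finite A" "finite B" by (rule finite_vertex, fact)+
    show "card A = card B" using Suc.prems(1) assms(1) by simp
  qed auto
  have "M \<in> V" using M(1,2) Suc.prems(1) assms(1) by auto
  have "(A, M) \<in> E ^^ (2 * t)"
    using \<open>M \<in> V\<close> M(3) by (intro Suc.IH) simp_all
  moreover have "(M, B) \<in> E ^^ 2"
    using M(4) Suc.prems(2) by (intro two_steps_sufficient \<open>M \<in> V\<close> Suc.prems(1)) simp
  ultimately have "(A, B) \<in> E ^^ (2 * t + 2)"
    unfolding relpow_add by (rule relcompI)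
  then show ?case by simp
qed

text \<open>Split off the last arc, which has length exactly \<open>k - i\<close> in the metric;
  both bounds are then triangle inequalities.\<close>

lemma odd_walk_necessary:
  assumes "A \<in> V" "(A, B) \<in> E ^^ (2 * t + 1)"
  shows "card (A - B) \<le> k - i + t * m" "k - i \<le> card (A - B) + t * m"
proof -
  obtain M where M: "(A, M) \<in> E ^^ (2 * t)" "(M, B) \<in> E"
    using assms(2) by auto
  have V: "M \<in> V" "B \<in> V" and r: "card (M - B) = k - i"
    using M by (auto simp: E_iff)
  have "card (A - M) \<le> t * m"
    by (rule conjunct2[OF even_walk_necessary[OF assms(1) M(1)]])
  moreover have "card (A - B) \<le> card (A - M) + card (M - B)"
    "card (M - B) \<le> card (M - A) + card (A - B)"
    using assms(1) V by (auto intro!: card_Diff_vertex_triangle)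
  ultimately show "card (A - B) \<le> k - i + t * m" "k - i \<le> card (A - B) + t * m"
    using r card_Diff_sym[OF assms(1) V(1)] by simp_all
qed

text \<open>The last vertex \<open>M\<close> before \<open>B\<close> must lie at distance exactly
  \<open>k - i\<close> from \<open>B\<close>. If \<open>A\<close> is too far from \<open>B\<close>,
  move towards \<open>B\<close>; if too close, move away, for which
  \<open>2 * k \<le> card S\<close> leaves enough room.\<close>

lemma odd_walk_sufficient:
  assumes V: "A \<in> V" "B \<in> V"
    and le: "card (A - B) \<le> k - i + t * m" "k - i \<le> card (A - B) + t * m"
  shows "(A, B) \<in> E ^^ (2 * t + 1)"
proof -
  let ?s = "card (A - B)"
  obtain M where M: "M \<in> V" "card (A - M) \<le> t * m" "card (M - B) = k - i"
  proof (cases "k - i \<le> ?s")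
    case True
    obtain M where "M \<subseteq> A \<union> B" "card M = card A" "card (A - M) = ?s - (k - i)"
      "card (M - B) = ?s - (?s - (k - i))"
    proof (rule intermediate_set[of A B "?s - (k - i)"])
      show "finite A" "finite B" by (rule finite_vertex, fact)+
      show "card A = card B" using V by simp
    qed auto
    then show ?thesis using V le True by (intro that[of M]) auto
  next
    case False
    have "(k - i) - ?s \<le> card (A \<inter> B)"
      using card_Int_vertex[OF V(1), of B] by simp
    moreover have "(k - i) - ?s \<le> card (S - (A \<union> B))"
      using card_outside[OF V] card_ge by simp
    ultimately obtain M where "M \<subseteq> S" "card M = card A" "card (A - M) = (k - i) - ?s"
      "card (M - B) = ?s + ((k - i) - ?s)"
      using V extension_set[OF finite_S, of A B "(k - i) - ?s"] by blast
    then show ?thesis using V le False by (intro that[of M]) auto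
  qed
  then have "(A, M) \<in> E ^^ (2 * t)" "(M, B) \<in> E"
    using V(2) by (simp_all add: even_walk_sufficient[OF V(1)] E_iff)
  then show ?thesis by (simp add: relcompI)
qed

definition steps :: "nat \<Rightarrow> nat \<Rightarrow> bool" where
  "steps n s \<longleftrightarrow> (if even n then s \<le> n div 2 * m
     else s \<le> k - i + n div 2 * m \<and> k - i \<le> s + n div 2 * m)"

lemma walk_iff_steps:
  assumes "A \<in> V" "B \<in> V"
  shows "(A, B) \<in> E ^^ n \<longleftrightarrow> steps n (card (A - B))"
proof (cases "even n")
  case True
  then obtain t where n: "n = 2 * t" by (elim evenE)
  show ?thesis
    unfolding n steps_def
    using even_walk_necessary[OF assms(1), of B t] even_walk_sufficient[OF assms, of t]
    by (simp del: relpow.simps) blast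
next
  case False
  then obtain t where n: "n = 2 * t + 1" by (elim oddE)
  show ?thesis
    unfolding n steps_def
    using odd_walk_necessary[OF assms(1), of B t] odd_walk_sufficient[OF assms, of t]
    by (simp del: relpow.simps) blast
qed

text \<open>Every value up to \<open>k\<close> really occurs, so that the diameter becomes a
  question about numbers \<open>s \<le> k\<close> alone. The set \<open>B\<close> arises by
  extending away from the pair \<open>A\<close>, \<open>A\<close>.\<close>

lemma vertices_at_distance:
  assumes "s \<le> k"
  obtains A B where "A \<in> V" "B \<in> V" "card (A - B) = s"
proof -
  obtain A where A: "A \<subseteq> S" "card A = k" "finite A"
    using card_ge by (elim obtain_subset_with_card_n[of k S, rotated]) auto
  then have "s \<le> card (A \<inter> A)" "s \<le> card (S - (A \<union> A))"
    using finite_S assms card_ge by (auto simp: card_Diff_subset)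
  then obtain B where "B \<subseteq> S" "card B = k" "card (A - B) = s"
    using A(2) by (elim extension_set[OF finite_S A(1) A(1)]) auto
  then show thesis using A that by blast
qed

lemma diameter_gen_johnson_eqI:
  assumes "\<And>s. s \<le> k \<Longrightarrow> \<exists>n\<le>N. steps n s"
    and "s \<le> k" "\<And>n. n < N \<Longrightarrow> \<not> steps n s"
  shows "diameter (with_proj (gen_johnson S k i)) = ereal (real N)"
proof -
  interpret pair_graph "gen_johnson S k i"
    using finite_S i_less by (rule pair_graph_gen_johnson)
  have V: "pverts (gen_johnson S k i) = V"
    by (simp add: gen_johnson_def)
  obtain A B where AB: "A \<in> V" "B \<in> V" "card (A - B) = s"
    using vertices_at_distance[OF assms(2)] by blast
  show ?thesis
  proof (rule diameter_eqI[unfolded with_proj_simps V])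
    show "A \<in> V" "B \<in> V" by fact+
    show "(A, B) \<notin> E ^^ n" if "n < N" for n
      unfolding walk_iff_steps[OF AB(1,2)] AB(3) using that by (rule assms(3))
    show "\<exists>n\<le>N. (C, D) \<in> E ^^ n" if CD: "C \<in> V" "D \<in> V" for C D
      unfolding walk_iff_steps[OF CD] using CD(1) by (intro assms(1) card_Diff_vertex_le)
  qed
qed

section \<open>The least number of steps that reaches all distances\<close>

definition covered :: "nat \<Rightarrow> bool" where
  "covered N \<longleftrightarrow> (\<forall>s\<le>k. \<exists>n\<le>N. steps n s)"

lemma not_covered_0: "\<not> covered 0"
  using i_less by (auto simp: covered_def steps_def intro!: exI[of _ 1])

text \<open>Within each parity the condition only weakens as \<open>n\<close> grows, so it suffices
  to test the largest even and the largest odd number up to \<open>Suc N\<close>.\<close>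

lemma ex_steps_iff:
  "(\<exists>n\<le>Suc N. steps n s) \<longleftrightarrow>
    s \<le> Suc N div 2 * m \<or> s \<le> k - i + N div 2 * m \<and> k - i \<le> s + N div 2 * m"
  (is "?L \<longleftrightarrow> ?R")
proof
  assume ?L
  then obtain n where n: "n \<le> Suc N" "steps n s" by blast
  show ?R
  proof (cases "even n")
    case True
    have "n div 2 * m \<le> Suc N div 2 * m" using n by (intro mult_right_mono div_le_mono) auto
    moreover have "s \<le> n div 2 * m" using n True by (simp add: steps_def)
    ultimately show ?thesis by (intro disjI1) linarith
  next
    case False
    then have "n div 2 \<le> N div 2" using n by presburger
    then have "n div 2 * m \<le> N div 2 * m" by (rule mult_right_mono) simp
    moreover have "s \<le> k - i + n div 2 * m" "k - i \<le> s + n div 2 * m"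
      using n False by (simp_all add: steps_def)
    ultimately show ?thesis by (intro disjI2 conjI) linarith+
  qed
next
  assume ?R
  then consider "s \<le> Suc N div 2 * m" |
    "s \<le> k - i + N div 2 * m" "k - i \<le> s + N div 2 * m" by blast
  then show ?L
  proof cases
    case 1
    then have "steps (2 * (Suc N div 2)) s" by (simp add: steps_def)
    moreover have "2 * (Suc N div 2) \<le> Suc N" by presburger
    ultimately show ?thesis by blast
  next
    case 2
    then have "steps (2 * (N div 2) + 1) s" by (simp add: steps_def)
    moreover have "2 * (N div 2) + 1 \<le> Suc N" by presburger
    ultimately show ?thesis by blast
  qed
qed

text \<open>Even walks reach the interval from 0 to \<open>?e\<close>, odd ones the interval of
  radius \<open>?o\<close> around \<open>k - i\<close>. Their union contains all
  \<open>s \<le> k\<close> iff there is no gap between them and one of them reaches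
  \<open>k\<close>.\<close>

lemma covered_Suc_iff:
  "covered (Suc N) \<longleftrightarrow> k - i - 1 \<le> N * m \<and> (i \<le> N div 2 * m \<or> k \<le> Suc N div 2 * m)"
proof -
  let ?e = "Suc N div 2 * m" and ?o = "N div 2 * m"
  have sum: "?e + ?o = N * m"
    by (simp flip: distrib_right) presburger
  have "covered (Suc N) \<longleftrightarrow> (\<forall>s\<le>k. s \<le> ?e \<or> s \<le> k - i + ?o \<and> k - i \<le> s + ?o)"
    unfolding covered_def ex_steps_iff ..
  also have "\<dots> \<longleftrightarrow> k - i - 1 \<le> ?e + ?o \<and> (i \<le> ?o \<or> k \<le> ?e)"
  proof (intro iffI conjI allI impI)
    assume *: "\<forall>s\<le>k. s \<le> ?e \<or> s \<le> k - i + ?o \<and> k - i \<le> s + ?o"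
    show "k - i - 1 \<le> ?e + ?o"
    \<comment> \<open>The first value beyond the even interval has to be in the odd one.\<close>
    proof (cases "Suc ?e \<le> k")
      case True
      with * have "k - i \<le> Suc ?e + ?o" using not_less_eq_eq by blast
      then show ?thesis by linarith
    qed linarith
    show "i \<le> ?o \<or> k \<le> ?e" using *[rule_format, of k] i_less by auto
  qed (use i_less in auto)
  finally show ?thesis unfolding sum .
qed

lemma diameter_eq_if_covered:
  assumes "covered (Suc N)" "\<not> covered N"
  shows "diameter (with_proj (gen_johnson S k i)) = ereal (real (Suc N))"
proof -
  obtain s where "s \<le> k" "\<not> (\<exists>n\<le>N. steps n s)"
    using assms(2) unfolding covered_def by blast
  then show ?thesis
    using assms(1) by (intro diameter_gen_johnson_eqI[of _ s]) (auto simp: covered_def)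
qed

end

text \<open>The ceiling as the least \<open>N\<close> with \<open>x \<le> N * d\<close>, the form in
  which it meets \<open>covered_Suc_iff\<close>.\<close>

lemma ceiling_divide_nat:
  fixes x d :: nat
  assumes "0 < d"
  obtains N where "\<lceil>real x / real d\<rceil> = int N" "x \<le> N * d" "\<And>M. M < N \<Longrightarrow> M * d < x"
proof -
  define N where "N = nat \<lceil>real x / real d\<rceil>"
  have N: "\<lceil>real x / real d\<rceil> = int N"
    unfolding N_def by (simp add: less_le_trans[of _ "0::real"])
  have le_iff: "x \<le> M * d \<longleftrightarrow> N \<le> M" for M
  proof -
    have "x \<le> M * d \<longleftrightarrow> real x \<le> real (M * d)"
      by (rule of_nat_le_iff[symmetric])
    also have "\<dots> \<longleftrightarrow> real x / real d \<le> real M"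
      using assms by (simp add: pos_divide_le_eq)
    also have "\<dots> \<longleftrightarrow> \<lceil>real x / real d\<rceil> \<le> int M"
      by (simp add: ceiling_le_iff)
    finally show ?thesis by (simp add: N)
  qed
  show thesis
    using N le_iff by (intro that[of N]) (auto simp: not_le[symmetric])
qed

section \<open>The diameter in the three ranges of the order\<close>

context johnson
begin

text \<open>Closing the gap between even and odd walks is the binding condition here, and it asks
  for \<open>?x \<le> N * m\<close>.\<close>

lemma diameter_small_order:
  assumes "0 < card S + 2 * i - 2 * k" "card S + 1 < 3 * (k - i) \<or> i = 0"
  shows "diameter (with_proj (gen_johnson S k i)) =
    ereal (of_int (\<lceil>real (k - i - 1) / real (card S + 2 * i - 2 * k)\<rceil> + 1))"
proof -
  let ?d = "card S + 2 * i - 2 * k" and ?x = "k - i - 1"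
  obtain N where N: "\<lceil>real ?x / real ?d\<rceil> = int N" "?x \<le> N * ?d" "\<And>M. M < N \<Longrightarrow> M * ?d < ?x"
    using ceiling_divide_nat[OF assms(1)] by blast
  have "?x \<le> N * m"
  proof (cases "?d \<le> 2 * (k - i)")
    case True
    then show ?thesis using N by (simp add: m_def)
  next
    \<comment> \<open>Now \<open>m\<close> exceeds \<open>?x\<close>, so one multiple of it
      suffices; \<open>N = 0\<close> only occurs for \<open>?x = 0\<close>.\<close>
    case False
    then have "m = 2 * (k - i)" by (simp add: m_def)
    then show ?thesis using N by (cases N) auto
  qed
  moreover have "i \<le> N div 2 * m"
  proof (cases "i = 0")
    case False
    \<comment> \<open>With \<open>i \<noteq> 0\<close> the order is so small that
      \<open>N \<ge> 2\<close>, hence \<open>N div 2 \<ge> 1\<close>, and a single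
      \<open>m = ?d \<ge> i\<close> is enough.\<close>
    then have d: "?d < ?x" using assms(2) card_ge by simp
    then have "m = ?d" by (simp add: m_def)
    moreover have "2 \<le> N"
    proof (rule ccontr)
      assume "\<not> 2 \<le> N"
      then have "N * ?d \<le> 1 * ?d" by (intro mult_right_mono) auto
      then show False using N(2) d by linarith
    qed
    then have "1 * m \<le> N div 2 * m" by (intro mult_right_mono) auto
    moreover have "i \<le> ?d" using card_ge by simp
    ultimately show ?thesis by linarith
  qed simp
  ultimately have "covered (Suc N)" by (simp add: covered_Suc_iff)
  moreover have "\<not> covered N"
  proof (cases N)
    case (Suc M)
    then have "M * ?d < ?x" using N by simp
    moreover have "M * m \<le> M * ?d" by (simp add: m_def)
    ultimately show ?thesis unfolding Suc covered_Suc_iff by linarith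
  qed (simp add: not_covered_0)
  ultimately show ?thesis
    unfolding N(1) using diameter_eq_if_covered[of N] by (simp add: add.commute)
qed

text \<open>Disjoint vertices are not adjacent as \<open>i \<noteq> 0\<close>, and have no common
  neighbour as \<Delta> is below \<open>k\<close>. Three steps suffice because \<open>m\<close> is
  at least both \<open>k - i - 1\<close> and \<open>i\<close>.\<close>

lemma diameter_medium_order:
  assumes "i \<noteq> 0" "3 * (k - i) \<le> card S + 1" "card S + 2 * i < 3 * k"
  shows "diameter (with_proj (gen_johnson S k i)) = ereal (of_int 3)"
proof -
  have "covered (Suc 2)"
    unfolding covered_Suc_iff using assms card_ge i_less by (auto simp: m_def)
  moreover have "\<not> covered (Suc 1)"
    unfolding covered_Suc_iff using assms by (auto simp: m_def)
  ultimately show ?thesis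
    using diameter_eq_if_covered[of 2] by (simp add: numeral_2_eq_2)
qed

text \<open>Here \<Delta> is at least \<open>k\<close>, so the binding condition is to reach
  distance \<open>k\<close> with steps of length \<open>k - i\<close>.\<close>

lemma diameter_large_order:
  assumes "i \<noteq> 0" "3 * k \<le> card S + 2 * i"
  shows "diameter (with_proj (gen_johnson S k i)) = ereal (of_int \<lceil>real k / real (k - i)\<rceil>)"
proof -
  let ?r = "k - i"
  obtain N where N: "\<lceil>real k / real ?r\<rceil> = int N" "k \<le> N * ?r" "\<And>M. M < N \<Longrightarrow> M * ?r < k"
    using ceiling_divide_nat[of ?r k] i_less by auto
  have "2 \<le> N"
  proof (rule ccontr)
    assume "\<not> 2 \<le> N"
    then have "N * ?r \<le> 1 * ?r" by (intro mult_right_mono) auto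
    then have "k \<le> ?r" using N(2) by linarith
    then show False using assms(1) i_less by simp
  qed
  then obtain M where NM: "N = Suc (Suc M)"
    by (metis Suc_le_D numeral_2_eq_2 Suc_le_mono)
  have "Suc M * m \<ge> 1 * m" by (intro mult_right_mono) auto
  then have "?r - 1 \<le> Suc M * m" using assms i_less by (simp add: m_def)
  moreover have "i \<le> Suc M div 2 * m \<or> k \<le> Suc (Suc M) div 2 * m"
  proof (cases "k \<le> 2 * ?r")
    \<comment> \<open>Two steps already reach every vertex.\<close>
    case True
    then have "k \<le> 1 * m" using assms by (simp add: m_def)
    also have "\<dots> \<le> Suc (Suc M) div 2 * m" by (intro mult_right_mono) auto
    finally show ?thesis by blast
  next
    case False
    then have m: "m = 2 * ?r" using assms by (simp add: m_def)
    show ?thesis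
    proof (cases "even M")
      case True
      then have "Suc (Suc M) div 2 * m = N * ?r" unfolding m NM by (auto elim!: evenE)
      then show ?thesis using N by simp
    next
      case False
      \<comment> \<open>For odd \<open>N\<close> the unpaired step contributes the missing
        \<open>?r\<close>, which turns \<open>k \<le> N * ?r\<close> into the bound on
        \<open>i\<close>.\<close>
      then have "Suc M div 2 * m + ?r = N * ?r" unfolding m NM by (auto elim!: oddE)
      then show ?thesis using N(2) by linarith
    qed
  qed
  ultimately have "covered (Suc (Suc M))" by (simp add: covered_Suc_iff)
  moreover have "\<not> covered (Suc M)"
  proof -
    \<comment> \<open>As \<open>m \<le> 2 * ?r\<close>, pairs of steps gain at most
      \<open>?r\<close> per step; this refutes both alternatives of
      \<open>covered_Suc_iff\<close>.\<close>
    have le: "j div 2 * m \<le> j * ?r" for j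
    proof -
      have "j div 2 * m \<le> j div 2 * (2 * ?r)" by (intro mult_left_mono) (simp_all add: m_def)
      also have "\<dots> = (j div 2 * 2) * ?r" by simp
      also have "\<dots> \<le> j * ?r" by (intro mult_right_mono) auto
      finally show ?thesis .
    qed
    have "Suc M * ?r < k" using N(3) NM by blast
    moreover from this have "M * ?r < i" using i_less by simp
    ultimately show ?thesis
      unfolding covered_Suc_iff using le[of M] le[of "Suc M"] by linarith
  qed
  ultimately show ?thesis
    unfolding N(1) NM using diameter_eq_if_covered[of "Suc M"] by simp
qed

end

theorem theorem4p4:
  fixes S :: "'a set" and v k i :: nat and \<Delta> :: int
  assumes "finite S" and "card S = v"
    and "v > k" and "k > i" and "v \<ge> 2 * k"
    and "(v, k, i) \<noteq> (2 * k, k, 0)"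
    and "\<Delta> = int v - 2 * int k + 2 * int i"
  shows "diameter (with_proj (gen_johnson S k i)) =
    ereal (of_int
      (if int v < 3 * (int k - int i) - 1 \<or> i = 0
       then \<lceil>(real k - real i - 1) / real_of_int \<Delta>\<rceil> + 1
       else if int v < 3 * int k - 2 * int i
       then 3
       else \<lceil>real k / (real k - real i)\<rceil>))"
proof -
  interpret johnson S k i
    using assms by unfold_locales auto
  \<comment> \<open>Since \<open>v \<ge> 2 * k\<close>, \<Delta> vanishes only for
    \<open>v = 2 * k\<close> and \<open>i = 0\<close>, the excluded triple.\<close>
  have pos: "0 < card S + 2 * i - 2 * k"
    using assms by auto
  have \<Delta>: "real_of_int \<Delta> = real (card S + 2 * i - 2 * k)"
    using assms by (simp add: of_nat_diff)
  have r: "real k - real i = real (k - i)" "real k - real i - 1 = real (k - i - 1)"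
    using assms by (auto simp: of_nat_diff)
  consider "int v < 3 * (int k - int i) - 1 \<or> i = 0" |
    "\<not> (int v < 3 * (int k - int i) - 1 \<or> i = 0)" "int v < 3 * int k - 2 * int i" |
    "\<not> (int v < 3 * (int k - int i) - 1 \<or> i = 0)" "\<not> int v < 3 * int k - 2 * int i"
    by blast
  then show ?thesis
  proof cases
    case 1
    then have "card S + 1 < 3 * (k - i) \<or> i = 0" using assms by auto
    then show ?thesis
      unfolding if_P[OF 1] \<Delta> r(2) by (rule diameter_small_order[OF pos])
  next
    case 2
    then have "i \<noteq> 0" "3 * (k - i) \<le> card S + 1" "card S + 2 * i < 3 * k" using assms by auto
    then show ?thesis
      unfolding if_not_P[OF 2(1)] if_P[OF 2(2)] by (rule diameter_medium_order)
  next
    case 3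
    then have "i \<noteq> 0" "3 * k \<le> card S + 2 * i" using assms by auto
    then show ?thesis
      unfolding if_not_P[OF 3(1)] if_not_P[OF 3(2)] r(1) by (rule diameter_large_order)
  qed
qed

end
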